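(* Let $R$ be a characteristic range set and let $Y$ be an ultrametrizable space. If $\mathrm{UMet}(Y;R)$ is a Borel subset of $\mathrm{UCPM}(Y;R)$, then $Y$ is separable.
   Context: A topological space is ultrametrizable if its topology is induced by some ultrametric. A range set is a set $R\subseteq[0,\infty)$ with $0\in R$; it is characteristic if for every $t>0$ there exists $r\in R\setminus\{0\}$ with $r\le t$. Write $a\lor b=\max\{a,b\}$. For a topological space $X$, an $R$-valued continuous pseudo-ultrametric on $X$ is a continuous map $d\colon X\times X\to[0,\infty)$ with $d(x,x)=0$, $d(x,y)=d(y,x)$, $d(x,z)\le d(x,y)\lor d(y,z)$ for all $x,y,z\in X$, and $d(X^2)\subseteq R$. $\mathrm{UCPM}(X;R)$ is the set of all of these, equipped with the topology induced by the ($[0,\infty]$-valued) metric $\mathcal{UD}_X^R(d,e)=\inf\{\varepsilon\in R\cup\{\infty\} : d(x,y)\le e(x,y)\lor\varepsilon \text{ and } e(x,y)\le d(x,y)\lor\varepsilon \text{ for all } x,y\in X\}$. $\mathrm{UMet}(X;R)\subseteq\mathrm{UCPM}(X;R)$ is the set of all $R$-valued ultrametrics on $X$ that induce the topology of $X$. *)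

theory Defs
  imports "HOL-Analysis.Analysis"
begin

definition range_set :: "real set \<Rightarrow> bool" where
  "range_set R \<longleftrightarrow> R \<subseteq> {0..} \<and> 0 \<in> R"

definition characteristic_range_set :: "real set \<Rightarrow> bool" where
  "characteristic_range_set R \<longleftrightarrow> range_set R \<and> (\<forall>t>0. \<exists>r\<in>R - {0}. r \<le> t)"

definition ultra_triangle_on :: "'a set \<Rightarrow> ('a \<Rightarrow> 'a \<Rightarrow> real) \<Rightarrow> bool" where
  "ultra_triangle_on M d \<longleftrightarrow> (\<forall>x\<in>M. \<forall>y\<in>M. \<forall>z\<in>M. d x z \<le> max (d x y) (d y z))"

definition induces_topology :: "('a \<Rightarrow> 'a \<Rightarrow> real) \<Rightarrow> 'a topology \<Rightarrow> bool" where
  "induces_topology d X \<longleftrightarrow>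
     Metric_space (topspace X) d \<and> Metric_space.mtopology (topspace X) d = X"

definition ultrametrizable_space :: "'a topology \<Rightarrow> bool" where
  "ultrametrizable_space X \<longleftrightarrow> (\<exists>d. ultra_triangle_on (topspace X) d \<and> induces_topology d X)"

text \<open>
  A function on the square of the carrier is represented by its extension by zero to the
  whole type, so that distinct HOL functions in \<open>UCPM X R\<close> are distinct maps on the carrier.
  (Extending by \<open>undefined\<close> would not do: the locale \<^locale>\<open>Metric_space\<close> requires
  nonnegativity outside of the carrier as well.)
\<close>

definition UCPM :: "'a topology \<Rightarrow> real set \<Rightarrow> ('a \<Rightarrow> 'a \<Rightarrow> real) set" where
  "UCPM X R = {d.
     (\<forall>x y. x \<notin> topspace X \<or> y \<notin> topspace X \<longrightarrow> d x y = 0) \<and>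
     continuous_map (prod_topology X X) (top_of_set {0..}) (\<lambda>(x, y). d x y) \<and>
     (\<forall>x\<in>topspace X. d x x = 0) \<and>
     (\<forall>x\<in>topspace X. \<forall>y\<in>topspace X. d x y = d y x) \<and>
     ultra_triangle_on (topspace X) d \<and>
     (\<forall>x\<in>topspace X. \<forall>y\<in>topspace X. d x y \<in> R)}"

definition UMet :: "'a topology \<Rightarrow> real set \<Rightarrow> ('a \<Rightarrow> 'a \<Rightarrow> real) set" where
  "UMet X R = {d \<in> UCPM X R. induces_topology d X}"

definition UD ::
    "'a topology \<Rightarrow> real set \<Rightarrow> ('a \<Rightarrow> 'a \<Rightarrow> real) \<Rightarrow> ('a \<Rightarrow> 'a \<Rightarrow> real) \<Rightarrow> ennreal" where
  "UD X R d e = Inf {\<epsilon> \<in> ennreal ` R \<union> {\<infinity>}. \<forall>x\<in>topspace X. \<forall>y\<in>topspace X.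
     ennreal (d x y) \<le> max (ennreal (e x y)) \<epsilon> \<and>
     ennreal (e x y) \<le> max (ennreal (d x y)) \<epsilon>}"

definition UCPM_topology :: "'a topology \<Rightarrow> real set \<Rightarrow> ('a \<Rightarrow> 'a \<Rightarrow> real) topology" where
  "UCPM_topology X R = topology (\<lambda>U. U \<subseteq> UCPM X R \<and>
     (\<forall>d\<in>U. \<exists>r>0. {e \<in> UCPM X R. UD X R d e < r} \<subseteq> U))"

lemma openin_UCPM_topology:
  "openin (UCPM_topology X R) U \<longleftrightarrow>
     U \<subseteq> UCPM X R \<and> (\<forall>d\<in>U. \<exists>r>0. {e \<in> UCPM X R. UD X R d e < r} \<subseteq> U)"
proof -
  let ?P = "\<lambda>U. U \<subseteq> UCPM X R \<and> (\<forall>d\<in>U. \<exists>r>0. {e \<in> UCPM X R. UD X R d e < r} \<subseteq> U)"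
  have "istopology ?P"
    unfolding istopology_def
  proof (intro conjI allI impI)
    fix S T assume S: "?P S" and T: "?P T"
    show "S \<inter> T \<subseteq> UCPM X R" using S by blast
    show "\<forall>d\<in>S \<inter> T. \<exists>r>0. {e \<in> UCPM X R. UD X R d e < r} \<subseteq> S \<inter> T"
    proof
      fix d assume "d \<in> S \<inter> T"
      then obtain r s where "r > 0" "s > 0" "{e \<in> UCPM X R. UD X R d e < r} \<subseteq> S"
          "{e \<in> UCPM X R. UD X R d e < s} \<subseteq> T"
        using S T by (meson IntE)
      then have "min r s > 0" "{e \<in> UCPM X R. UD X R d e < min r s} \<subseteq> S \<inter> T"
        by auto
      then show "\<exists>r>0. {e \<in> UCPM X R. UD X R d e < r} \<subseteq> S \<inter> T" by blast
    qed
  next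
    fix K assume K: "\<forall>S\<in>K. ?P S"
    then show "\<Union>K \<subseteq> UCPM X R" by blast
    show "\<forall>d\<in>\<Union>K. \<exists>r>0. {e \<in> UCPM X R. UD X R d e < r} \<subseteq> \<Union>K"
    proof
      fix d assume "d \<in> \<Union>K"
      then obtain S where "S \<in> K" "d \<in> S" by blast
      moreover from this obtain r where "r > 0" "{e \<in> UCPM X R. UD X R d e < r} \<subseteq> S"
        using K by meson
      ultimately show "\<exists>r>0. {e \<in> UCPM X R. UD X R d e < r} \<subseteq> \<Union>K" by blast
    qed
  qed
  then show ?thesis
    unfolding UCPM_topology_def by (simp add: topology_inverse')
qed

lemma topspace_UCPM_topology [simp]: "topspace (UCPM_topology X R) = UCPM X R"
proof
  show "topspace (UCPM_topology X R) \<subseteq> UCPM X R"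
    by (meson openin_UCPM_topology openin_topspace)
  have "openin (UCPM_topology X R) (UCPM X R)"
    unfolding openin_UCPM_topology by (auto intro: exI[of _ 1])
  then show "UCPM X R \<subseteq> topspace (UCPM_topology X R)"
    by (rule openin_subset)
qed

definition borel_in :: "'a topology \<Rightarrow> 'a set \<Rightarrow> bool" where
  "borel_in T A \<longleftrightarrow> A \<in> sigma_sets (topspace T) {U. openin T U}"

end

theory Submission
  imports Defs
begin

text \<open>
  If \<open>Y\<close> is not separable, then for some \<open>\<epsilon>\<close> the \<open>\<epsilon>\<close>-balls of an \<open>R\<close>-valued ultrametric
  partition \<open>Y\<close> into uncountably many clopen classes. Among their representatives take a set \<open>J\<close>
  of order type \<open>\<omega>\<^sub>1\<close> and let the sequence \<open>w x\<close> enumerate the predecessors of \<open>x \<in> J\<close>. A sequence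
  \<open>s\<close> determines a pseudo-ultrametric that shrinks the class of \<open>x\<close> to the size \<open>d(s, w x)\<close>, where \<open>d\<close>
  is the \<open>R\<close>-valued first-difference ultrametric on sequences. It depends continuously on \<open>s\<close>,
  and it belongs to \<open>UMet Y R\<close> when \<open>s\<close> is none of the \<open>w x\<close>, but not when \<open>s\<close> is a non-isolated
  point of the set of all \<open>w x\<close>. So a Borel \<open>UMet Y R\<close> would yield a Suslin set of sequences \<open>w x\<close>
  that contains all of them except the isolated ones. By a pressing-down argument this set is not
  \<open>\<sigma>\<close>-discrete, hence it contains a Cantor set. This is impossible, since only countably many
  \<open>w x\<close> have all entries in a given countable set.
\<close>

section \<open>Sigma-thin index sets\<close>

text \<open>Every cylinder of length \<open>k\<close> contains \<open>w x\<close> for only countably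
  many \<open>x\<close> in \<open>S\<close>: uniform discreteness up to countable fibres. Counting
  indices instead of sequences allows \<open>w\<close> to be non-injective.\<close>

definition thin_at :: "nat \<Rightarrow> ('i \<Rightarrow> nat \<Rightarrow> 'b) \<Rightarrow> 'i set \<Rightarrow> bool" where
  "thin_at k w S \<longleftrightarrow> (\<forall>t. countable {x \<in> S. \<forall>i<k. w x i = t i})"

definition sigma_thin :: "('i \<Rightarrow> nat \<Rightarrow> 'b) \<Rightarrow> 'i set \<Rightarrow> bool" where
  "sigma_thin w S \<longleftrightarrow> (\<exists>T::nat \<Rightarrow> 'i set. S \<subseteq> (\<Union>n. T n) \<and> (\<forall>n. \<exists>k. thin_at k w (T n)))"

lemma sigma_thinI:
  assumes "thin_at k w S"
  shows "sigma_thin w S"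
  unfolding sigma_thin_def using assms by (intro exI[of _ "\<lambda>_. S"] conjI allI exI[of _ k]) simp_all

lemma sigma_thin_subset:
  assumes "sigma_thin w S" "S' \<subseteq> S"
  shows "sigma_thin w S'"
proof -
  obtain T :: "nat \<Rightarrow> 'a set" where "S \<subseteq> (\<Union>n. T n)" "\<forall>n. \<exists>k. thin_at k w (T n)"
    using assms(1) unfolding sigma_thin_def by (elim exE conjE)
  then show ?thesis unfolding sigma_thin_def
    by (intro exI[of _ T] conjI) (use assms(2) in auto)
qed

lemma sigma_thin_UN:
  fixes S :: "nat \<Rightarrow> 'i set"
  assumes "\<And>n. sigma_thin w (S n)"
  shows "sigma_thin w (\<Union>n. S n)"
proof -
  have "\<forall>n. \<exists>T::nat \<Rightarrow> 'i set. S n \<subseteq> (\<Union>m. T m) \<and> (\<forall>m. \<exists>k. thin_at k w (T m))"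
    using assms unfolding sigma_thin_def by blast
  from choice[OF this] obtain T :: "nat \<Rightarrow> nat \<Rightarrow> 'i set" where
    T: "\<And>n. S n \<subseteq> (\<Union>m. T n m)" "\<And>n m. \<exists>k. thin_at k w (T n m)"
    by blast
  let ?T = "\<lambda>j. case_prod T (prod_decode j)"
  have "(\<Union>n. S n) \<subseteq> (\<Union>j. ?T j)"
  proof
    fix x assume "x \<in> (\<Union>n. S n)"
    then obtain n m where "x \<in> T n m" using T(1) by blast
    then have "x \<in> ?T (prod_encode (n, m))" by simp
    then show "x \<in> (\<Union>j. ?T j)" by (rule UN_I[OF UNIV_I])
  qed
  moreover have "\<exists>k. thin_at k w (?T j)" for j
    using T(2) by (simp add: case_prod_beta)
  ultimately show ?thesis unfolding sigma_thin_def
    by (intro exI[of _ ?T] conjI allI)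
qed

lemma sigma_thin_UN_countable:
  assumes "countable A" "\<And>a. a \<in> A \<Longrightarrow> sigma_thin w (S a)"
  shows "sigma_thin w (\<Union>a\<in>A. S a)"
proof (cases "A = {}")
  case True
  then show ?thesis by (auto intro!: sigma_thinI[of 0] simp: thin_at_def)
next
  case False
  have "sigma_thin w (\<Union>n. S (from_nat_into A n))"
    using assms(2) from_nat_into[OF False] by (intro sigma_thin_UN) blast
  moreover have "(\<Union>n. S (from_nat_into A n)) = (\<Union>a\<in>A. S a)"
    using range_from_nat_into[OF False assms(1)] by (metis image_image)
  ultimately show ?thesis by simp
qed

lemma sigma_thin_countable: "countable S \<Longrightarrow> sigma_thin w S"
  by (rule sigma_thinI[of 0]) (simp add: thin_at_def)

lemma sigma_thin_Un:
  assumes "sigma_thin w S" "sigma_thin w S'"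
  shows "sigma_thin w (S \<union> S')"
proof -
  have "sigma_thin w (\<Union>a\<in>{S, S'}. a)"
    using assms by (intro sigma_thin_UN_countable) auto
  then show ?thesis by simp
qed

lemma sigma_thin_inj_on:
  assumes "\<And>x y. x \<in> S \<Longrightarrow> y \<in> S \<Longrightarrow> (\<forall>i<k. w x i = w y i) \<Longrightarrow> x = y"
  shows "sigma_thin w S"
proof -
  have "countable {x \<in> S. \<forall>i<k. w x i = t i}" for t
  proof (cases "{x \<in> S. \<forall>i<k. w x i = t i} = {}")
    case False
    then obtain a where "a \<in> S" "\<forall>i<k. w a i = t i" by blast
    then have "{x \<in> S. \<forall>i<k. w x i = t i} \<subseteq> {a}" using assms by auto
    then show ?thesis by (rule countable_subset) simp
  next
    case True
    then show ?thesis by (simp only: countable_empty)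
  qed
  then show ?thesis by (intro sigma_thinI[of k]) (simp add: thin_at_def)
qed

text \<open>Although \<open>V\<close> may be uncountable, the union of the fibres stays thin: on it the
  \<open>n\<close>-th coordinate of \<open>w x\<close> tells in which fibre \<open>x\<close> lies.\<close>

lemma sigma_thin_fibres:
  fixes w :: "'i \<Rightarrow> nat \<Rightarrow> 'b"
  assumes "\<And>v. v \<in> V \<Longrightarrow> sigma_thin w {x \<in> S. w x n = v}"
  shows "sigma_thin w {x \<in> S. w x n \<in> V}"
proof -
  have "\<forall>v. \<exists>T::nat \<Rightarrow> 'i set. v \<in> V \<longrightarrow>
      {x \<in> S. w x n = v} \<subseteq> (\<Union>m. T m) \<and> (\<forall>m. \<exists>k. thin_at k w (T m))"
  proof
    fix v
    show "\<exists>T::nat \<Rightarrow> 'i set. v \<in> V \<longrightarrow>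
      {x \<in> S. w x n = v} \<subseteq> (\<Union>m. T m) \<and> (\<forall>m. \<exists>k. thin_at k w (T m))"
      using assms[of v, unfolded sigma_thin_def] by (cases "v \<in> V") simp_all
  qed
  from choice[OF this] obtain T :: "'b \<Rightarrow> nat \<Rightarrow> 'i set" where
    "\<forall>v. v \<in> V \<longrightarrow>
      {x \<in> S. w x n = v} \<subseteq> (\<Union>m. T v m) \<and> (\<forall>m. \<exists>k. thin_at k w (T v m))"
    by (elim exE)
  then have T: "{x \<in> S. w x n = v} \<subseteq> (\<Union>m. T v m)" "\<exists>k. thin_at k w (T v m)"
    if "v \<in> V" for v m
    using that by simp_all
  define k where "k v m = (SOME k. thin_at k w (T v m))" for v m
  have k: "thin_at (k v m) w (T v m)" if "v \<in> V" for v m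
    unfolding k_def using T(2)[OF that] by (rule someI_ex)
  \<comment> \<open>Sorting by the prefix length \<open>j\<close> lets one length serve all fibres
    at once: \<open>max j (Suc n)\<close> covers \<open>j\<close> and also the coordinate
    \<open>n\<close> that identifies the fibre.\<close>
  define T' where "T' m j = {x. w x n \<in> V \<and> k (w x n) m = j \<and> x \<in> T (w x n) m}" for m j
  have "sigma_thin w (T' m j)" for m j
  proof -
    have "countable {x \<in> T' m j. \<forall>i<max j (Suc n). w x i = t i}" for t
    proof (cases "t n \<in> V \<and> k (t n) m = j")
      case True
      have "{x \<in> T' m j. \<forall>i<max j (Suc n). w x i = t i}
          \<subseteq> {x \<in> T (t n) m. \<forall>i<k (t n) m. w x i = t i}"
        using True by (auto simp: T'_def)
      moreover have "countable {x \<in> T (t n) m. \<forall>i<k (t n) m. w x i = t i}"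
        using k True unfolding thin_at_def by blast
      ultimately show ?thesis by (rule countable_subset)
    next
      case False
      then have "\<not> (\<forall>i<max j (Suc n). w x i = t i)" if "x \<in> T' m j" for x
        using that by (auto simp: T'_def intro!: exI[of _ n])
      then have "{x \<in> T' m j. \<forall>i<max j (Suc n). w x i = t i} = {}" by blast
      then show ?thesis by (simp only: countable_empty)
    qed
    then show ?thesis by (intro sigma_thinI[of "max j (Suc n)"]) (simp add: thin_at_def)
  qed
  then have "sigma_thin w (\<Union>m. \<Union>j. T' m j)"
    by (intro sigma_thin_UN)
  moreover have "{x \<in> S. w x n \<in> V} \<subseteq> (\<Union>m. \<Union>j. T' m j)"
    using T(1) by (fastforce simp: T'_def)
  ultimately show ?thesis by (rule sigma_thin_subset)
qed

lemma not_sigma_thin_fibre: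
  assumes "\<not> sigma_thin w S"
  obtains v where "\<not> sigma_thin w {x \<in> S. w x n = v}"
  using sigma_thin_fibres[of UNIV w S n] assms by auto

lemma not_sigma_thin_countable_fibre:
  fixes h :: "'i \<Rightarrow> 'c::countable"
  assumes "\<not> sigma_thin w S"
  obtains v where "\<not> sigma_thin w {x \<in> S. h x = v}"
proof (rule ccontr)
  assume "\<not> thesis"
  then have "sigma_thin w (\<Union>v. {x \<in> S. h x = v})"
    using that by (intro sigma_thin_UN_countable) auto
  moreover have "(\<Union>v. {x \<in> S. h x = v}) = S" by auto
  ultimately show False using assms by simp
qed

text \<open>Coordinates are fixed one at a time: \<open>w x n\<close> by the fibre lemma, however
  many values it takes, and \<open>h x n\<close> because it takes only countably many.\<close>

lemma not_sigma_thin_cylinder: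
  fixes h :: "'i \<Rightarrow> nat \<Rightarrow> 'c::countable"
  assumes "\<not> sigma_thin w S"
  shows "\<exists>S'\<subseteq>S. \<not> sigma_thin w S' \<and>
    (\<forall>x\<in>S'. \<forall>y\<in>S'. \<forall>i<(n::nat). w x i = w y i \<and> h x i = h y i)"
proof (induction n)
  case 0
  then show ?case using assms by auto
next
  case (Suc n)
  then obtain S' where S': "S' \<subseteq> S" "\<not> sigma_thin w S'"
      "\<forall>x\<in>S'. \<forall>y\<in>S'. \<forall>i<n. w x i = w y i \<and> h x i = h y i" by blast
  obtain v where v: "\<not> sigma_thin w {x \<in> S'. w x n = v}"
    using not_sigma_thin_fibre S'(2) by blast
  obtain c where "\<not> sigma_thin w {x \<in> {x \<in> S'. w x n = v}. h x n = c}"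
    using not_sigma_thin_countable_fibre[OF v, of "\<lambda>x. h x n"] by blast
  then show ?case
    using S' by (intro exI[of _ "{x \<in> {x \<in> S'. w x n = v}. h x n = c}"])
      (auto simp: less_Suc_eq)
qed

text \<open>Otherwise each coordinate \<open>n\<close> has exactly one non-thin fibre, over
  \<open>t n\<close>. Then \<open>S\<close> is covered by the thin sets on which
  \<open>w x n\<close> differs from \<open>t n\<close> and the countable set on which
  \<open>w x = t\<close>.\<close>

lemma not_sigma_thin_split:
  assumes "\<not> sigma_thin w S" and fin: "\<And>t. countable {x \<in> S. \<forall>i. w x i = t i}"
  shows "\<exists>n a b. a \<noteq> b \<and> \<not> sigma_thin w {x \<in> S. w x n = a} \<and> \<not> sigma_thin w {x \<in> S. w x n = b}"
proof (rule ccontr)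
  assume neg: "\<not> ?thesis"
  have "\<exists>v. \<not> sigma_thin w {x \<in> S. w x n = v}" for n
    using not_sigma_thin_fibre[OF assms(1)] by blast
  then obtain t where t: "\<And>n. \<not> sigma_thin w {x \<in> S. w x n = t n}"
    by metis
  have "sigma_thin w {x \<in> S. w x n \<in> - {t n}}" for n
  proof (rule sigma_thin_fibres)
    fix v assume "v \<in> - {t n}"
    then show "sigma_thin w {x \<in> S. w x n = v}" using neg t[of n] by auto
  qed
  then have "sigma_thin w ((\<Union>n. {x \<in> S. w x n \<in> - {t n}}) \<union> {x \<in> S. \<forall>i. w x i = t i})"
    by (rule sigma_thin_Un[OF sigma_thin_UN sigma_thin_countable[OF fin]])
  moreover have "S \<subseteq> (\<Union>n. {x \<in> S. w x n \<in> - {t n}}) \<union> {x \<in> S. \<forall>i. w x i = t i}"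
    by auto
  ultimately have "sigma_thin w S" by (rule sigma_thin_subset)
  then show False using assms(1) by simp
qed

section \<open>Suslin sets of sequences\<close>

text \<open>Limits are tested on common prefixes, so this is closedness in a product of discrete
  spaces.\<close>

definition seq_closed :: "((nat \<Rightarrow> 'b) \<times> (nat \<Rightarrow> nat)) set \<Rightarrow> bool" where
  "seq_closed C \<longleftrightarrow> (\<forall>s u. (\<forall>n. \<exists>s' u'. (s', u') \<in> C \<and> (\<forall>i<n. s' i = s i \<and> u' i = u i)) \<longrightarrow> (s, u) \<in> C)"

text \<open>Projections of closed sets along Baire space. Open and closed sets are of this kind, and
  countable unions and intersections preserve it, so it captures all Borel sets.\<close>

definition suslin :: "(nat \<Rightarrow> 'b) set \<Rightarrow> bool" where
  "suslin B \<longleftrightarrow> (\<exists>C. seq_closed C \<and> B = fst ` C)"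

lemma seq_closedD:
  assumes "seq_closed C" "\<And>n. \<exists>s' u'. (s', u') \<in> C \<and> (\<forall>i<n. s' i = s i \<and> u' i = u i)"
  shows "(s, u) \<in> C"
  using assms(1)[unfolded seq_closed_def, rule_format, OF assms(2)] .

lemma suslin_UN:
  fixes B :: "nat \<Rightarrow> (nat \<Rightarrow> 'b) set"
  assumes "\<And>n. suslin (B n)"
  shows "suslin (\<Union>n. B n)"
proof -
  obtain C where C: "\<And>n. seq_closed (C n)" "\<And>n. B n = fst ` C n"
    using assms unfolding suslin_def by metis
  \<comment> \<open>The first entry of \<open>u\<close> selects one of the sets \<open>C n\<close>;
    the other entries are the witness for it.\<close>
  define D where "D = {(s, u). (s, \<lambda>i. u (Suc i)) \<in> C (u 0)}"
  have "seq_closed D"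
    unfolding seq_closed_def
  proof (intro allI impI)
    fix s u assume *: "\<forall>n. \<exists>s' u'. (s', u') \<in> D \<and> (\<forall>i<n. s' i = s i \<and> u' i = u i)"
    have "(s, \<lambda>i. u (Suc i)) \<in> C (u 0)"
    proof (rule seq_closedD[OF C(1)])
      fix n
      obtain s' u' where "(s', u') \<in> D" "\<forall>i<Suc n. s' i = s i \<and> u' i = u i"
        using * by blast
      then show "\<exists>s' u'. (s', u') \<in> C (u 0) \<and> (\<forall>i<n. s' i = s i \<and> u' i = u (Suc i))"
        by (intro exI[of _ s'] exI[of _ "\<lambda>i. u' (Suc i)"]) (auto simp: D_def)
    qed
    then show "(s, u) \<in> D" by (simp add: D_def)
  qed
  moreover have "(\<Union>n. B n) = fst ` D"
  proof
    show "(\<Union>n. B n) \<subseteq> fst ` D"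
    proof
      fix s assume "s \<in> (\<Union>n. B n)"
      then obtain n u where "(s, u) \<in> C n" using C(2) by auto
      then have "(s, case_nat n u) \<in> D" by (simp add: D_def)
      then show "s \<in> fst ` D" by force
    qed
    show "fst ` D \<subseteq> (\<Union>n. B n)" using C(2) by (force simp: D_def)
  qed
  ultimately show ?thesis unfolding suslin_def by blast
qed

lemma suslin_INT:
  fixes B :: "nat \<Rightarrow> (nat \<Rightarrow> 'b) set"
  assumes "\<And>n. suslin (B n)"
  shows "suslin (\<Inter>n. B n)"
proof -
  obtain C where C: "\<And>n. seq_closed (C n)" "\<And>n. B n = fst ` C n"
    using assms unfolding suslin_def by metis
  \<comment> \<open>A single \<open>u\<close> stores a witness for every \<open>n\<close>, in row
    \<open>n\<close> of the pairing \<open>prod_encode\<close>.\<close>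
  define D where "D = {(s, u). \<forall>n. (s, \<lambda>i. u (prod_encode (n, i))) \<in> C n}"
  have "seq_closed D"
    unfolding seq_closed_def
  proof (intro allI impI)
    fix s u assume *: "\<forall>n. \<exists>s' u'. (s', u') \<in> D \<and> (\<forall>i<n. s' i = s i \<and> u' i = u i)"
    have "(s, \<lambda>i. u (prod_encode (n, i))) \<in> C n" for n
    proof (rule seq_closedD[OF C(1)])
      fix m
      \<comment> \<open>A prefix of length \<open>N\<close> must contain the first \<open>m\<close>
        entries of row \<open>n\<close> of \<open>u\<close> and the first \<open>m\<close> entries
        of \<open>s\<close>.\<close>
      have "finite ((\<lambda>i. prod_encode (n, i)) ` {..<m} \<union> {..<m})" by simp
      then obtain N where "\<forall>j\<in>(\<lambda>i. prod_encode (n, i)) ` {..<m} \<union> {..<m}. j < N"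
        using finite_nat_set_iff_bounded by blast
      moreover obtain s' u' where "(s', u') \<in> D" "\<forall>i<N. s' i = s i \<and> u' i = u i"
        using * by blast
      ultimately show "\<exists>s' u'. (s', u') \<in> C n \<and>
          (\<forall>i<m. s' i = s i \<and> u' i = u (prod_encode (n, i)))"
        by (intro exI[of _ s'] exI[of _ "\<lambda>i. u' (prod_encode (n, i))"]) (auto simp: D_def)
    qed
    then show "(s, u) \<in> D" by (simp add: D_def)
  qed
  moreover have "(\<Inter>n. B n) = fst ` D"
  proof
    show "(\<Inter>n. B n) \<subseteq> fst ` D"
    proof
      fix s assume "s \<in> (\<Inter>n. B n)"
      then have "\<forall>n. \<exists>u. (s, u) \<in> C n" using C(2) by force
      then obtain u where "\<And>n. (s, u n) \<in> C n" by metis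
      then have "(s, \<lambda>j. case_prod u (prod_decode j)) \<in> D" by (simp add: D_def)
      then show "s \<in> fst ` D" by force
    qed
    show "fst ` D \<subseteq> (\<Inter>n. B n)" using C(2) by (force simp: D_def)
  qed
  ultimately show ?thesis unfolding suslin_def by blast
qed

text \<open>For the open set \<open>B\<close>, the entry \<open>u 0\<close> records the length of a
  cylinder around \<open>s\<close> inside \<open>B\<close>. Its complement is closed, and every
  \<open>u\<close> is a witness there.\<close>

lemma suslin_open:
  assumes "\<And>s. s \<in> B \<Longrightarrow> \<exists>n. {t. \<forall>i<n. t i = s i} \<subseteq> B"
  shows "suslin B" and "suslin (- B)"
proof -
  let ?C = "{(s, u). {t. \<forall>i<u (0::nat). t i = s i} \<subseteq> B}"
  have "seq_closed ?C"
    unfolding seq_closed_def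
  proof (intro allI impI)
    fix s u assume *: "\<forall>n. \<exists>s' u'. (s', u') \<in> ?C \<and> (\<forall>i<n. s' i = s i \<and> u' i = u i)"
    \<comment> \<open>\<open>Suc\<close> puts index 0 into the prefix, so that
      \<open>u' 0 = u 0\<close> holds even if \<open>u 0 = 0\<close>.\<close>
    from spec[OF this, of "Suc (u 0)"] obtain s' u'
      where su: "{t. \<forall>i<u' 0. t i = s' i} \<subseteq> B" "\<And>i. i \<le> u 0 \<Longrightarrow> s' i = s i \<and> u' i = u i"
      by (auto simp: less_Suc_eq_le)
    then have "u' 0 = u 0" by simp
    moreover have "(\<forall>i<u 0. t i = s' i) \<longleftrightarrow> (\<forall>i<u 0. t i = s i)" for t
      using su(2) by simp
    ultimately show "(s, u) \<in> ?C" using su(1) by simp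
  qed
  moreover have "B = fst ` ?C"
  proof
    show "B \<subseteq> fst ` ?C"
    proof
      fix s assume "s \<in> B"
      then obtain n where "{t. \<forall>i<n. t i = s i} \<subseteq> B" using assms by blast
      then have "(s, \<lambda>_. n) \<in> ?C" by simp
      then show "s \<in> fst ` ?C" by (rule image_eqI[rotated]) simp
    qed
  qed auto
  ultimately show "suslin B" unfolding suslin_def by blast
  let ?D = "(- B) \<times> (UNIV :: (nat \<Rightarrow> nat) set)"
  have "seq_closed ?D"
    unfolding seq_closed_def
  proof (intro allI impI)
    fix s and u :: "nat \<Rightarrow> nat"
    assume *: "\<forall>n. \<exists>s' u'. (s', u') \<in> ?D \<and> (\<forall>i<n. s' i = s i \<and> u' i = u i)"
    have "s \<notin> B"
    proof
      assume "s \<in> B"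
      then obtain n where n: "{t. \<forall>i<n. t i = s i} \<subseteq> B" using assms by blast
      from spec[OF *, of n] obtain s' where "s' \<notin> B" "\<forall>i<n. s' i = s i" by auto
      then show False using n by blast
    qed
    then show "(s, u) \<in> ?D" by simp
  qed
  moreover have "- B = fst ` ?D" by simp
  ultimately show "suslin (- B)" unfolding suslin_def by blast
qed

text \<open>A Cantor scheme inside \<open>N\<close> would produce uncountably many points of \<open>N\<close> with all
  entries in one countable set.\<close>

lemma suslin_sigma_thin:
  fixes w :: "'i \<Rightarrow> nat \<Rightarrow> 'b"
  assumes N: "suslin N" "N \<subseteq> w ` J"
    and cnt: "\<And>C. countable C \<Longrightarrow> countable {x \<in> J. range (w x) \<subseteq> C}"
  shows "sigma_thin w {x \<in> J. w x \<in> N}"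
proof (rule ccontr)
  define A where "A = {x \<in> J. w x \<in> N}"
  assume "\<not> sigma_thin w {x \<in> J. w x \<in> N}"
  then have A: "\<not> sigma_thin w A" by (simp add: A_def)
  obtain C where C: "seq_closed C" "N = fst ` C" using N(1) unfolding suslin_def by blast
  have "\<forall>x\<in>A. \<exists>u. (w x, u) \<in> C" unfolding A_def C(2) by force
  \<comment> \<open>\<open>h x\<close> witnesses that \<open>w x\<close> lies in \<open>N\<close>.
    The scheme has to control it together with \<open>w x\<close> for the limits to stay in
    \<open>C\<close>.\<close>
  then obtain h where h: "\<And>x. x \<in> A \<Longrightarrow> (w x, h x) \<in> C" by metis
  have fin: "countable {x \<in> S. \<forall>i. w x i = t i}" if "S \<subseteq> A" for S t
    by (rule countable_subset[OF _ cnt[of "range t"]]) (use that in \<open>auto simp: A_def\<close>)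
  define agree where "agree n T \<longleftrightarrow> (\<forall>x\<in>T. \<forall>y\<in>T. \<forall>i<n. w x i = w y i \<and> h x i = h y i)"
    for n :: nat and T
  \<comment> \<open>One node of the Cantor scheme: two non-thin halves separated at a coordinate
    \<open>m\<close>, the members of each half sharing their prefixes of length \<open>n\<close> in
    both \<open>w\<close> and \<open>h\<close>.\<close>
  let ?Q = "\<lambda>S n (T::bool \<Rightarrow> 'i set). (\<forall>b. T b \<subseteq> S \<and> \<not> sigma_thin w (T b) \<and> agree n (T b)) \<and>
      (\<exists>m. \<forall>x\<in>T True. \<forall>y\<in>T False. w x m \<noteq> w y m)"
  have step: "\<exists>T. ?Q S n T" if S: "S \<subseteq> A" "\<not> sigma_thin w S" for S n
  proof -
    obtain m a b where ab: "a \<noteq> b" "\<not> sigma_thin w {x \<in> S. w x m = a}"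
        "\<not> sigma_thin w {x \<in> S. w x m = b}"
      using not_sigma_thin_split[OF S(2) fin[OF S(1)]] by blast
    obtain T1 where T1: "T1 \<subseteq> {x \<in> S. w x m = a}" "\<not> sigma_thin w T1"
        "agree n T1"
      using not_sigma_thin_cylinder[OF ab(2), of n h] unfolding agree_def by blast
    obtain T2 where T2: "T2 \<subseteq> {x \<in> S. w x m = b}" "\<not> sigma_thin w T2"
        "agree n T2"
      using not_sigma_thin_cylinder[OF ab(3), of n h] unfolding agree_def by blast
    have "\<forall>x\<in>T1. \<forall>y\<in>T2. w x m \<noteq> w y m" using T1 T2 ab(1) by blast
    then have "\<exists>m. \<forall>x\<in>T1. \<forall>y\<in>T2. w x m \<noteq> w y m" by (rule exI)
    moreover have "T1 \<subseteq> S" "T2 \<subseteq> S" using T1(1) T2(1) by auto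
    ultimately show ?thesis
      using T1(2,3) T2(2,3) by (intro exI[of _ "\<lambda>c. if c then T1 else T2"]) simp
  qed
  define G where "G S n = (SOME T. ?Q S n T)" for S n
  have G: "?Q S n (G S n)" if "S \<subseteq> A" "\<not> sigma_thin w S" for S n
    unfolding G_def by (rule someI_ex[OF step[OF that]])
  \<comment> \<open>Nodes are indexed by the bits chosen so far, the latest first. Each half of node
    \<open>l\<close> is constant on the coordinates below \<open>length l\<close>.\<close>
  define P where "P = rec_list A (\<lambda>b l S. G S (length l) b)"
  have P_simps: "P [] = A" "P (b # l) = G (P l) (length l) b" for b l
    by (simp_all add: P_def)
  have P: "P l \<subseteq> A \<and> \<not> sigma_thin w (P l)" for l
  proof (induction l)
    case Nil then show ?case using A by (simp add: P_simps)
  next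
    case (Cons b l) then show ?case using G[of "P l" "length l"] by (simp add: P_simps subset_trans[of _ "P l" A])
  qed
  have P_sub: "P (b # l) \<subseteq> P l" for b l
    using G[of "P l" "length l"] P[of l] by (simp add: P_simps)
  have P_eq: "w x i = w y i \<and> h x i = h y i"
    if "x \<in> P (b # l)" "y \<in> P (b # l)" "i < length l" for x y i b l
  proof -
    have "agree (length l) (P (b # l))" using G[of "P l" "length l"] P[of l] by (simp add: P_simps)
    then show ?thesis using that unfolding agree_def by blast
  qed
  have P_split: "\<exists>m. \<forall>x\<in>P (True # l). \<forall>y\<in>P (False # l). w x m \<noteq> w y m" for l
    using G[of "P l" "length l"] P[of l] by (simp add: P_simps)
  define pt where "pt l = (SOME x. x \<in> P l)" for l
  have pt: "pt l \<in> P l" for l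
  proof -
    have "P l \<noteq> {}" using P[of l] sigma_thin_countable[of "{}" w] by auto
    then show ?thesis unfolding pt_def by (simp add: some_in_eq)
  qed
  \<comment> \<open>Countable since there are only countably many nodes, although it contains the
    entries of the limits along all branches.\<close>
  define C0 where "C0 = range (\<lambda>(l, n). w (pt l) n)"
  have C0: "countable C0" unfolding C0_def by simp
  define br :: "(nat \<Rightarrow> bool) \<Rightarrow> nat \<Rightarrow> bool list" where "br b n = rev (map b [0..<n])" for b n
  have br_Suc: "br b (Suc n) = b n # br b n" and br_len: "length (br b n) = n" for b n
    by (simp_all add: br_def)
  have br_mono: "P (br b n) \<subseteq> P (br b m)" if "m \<le> n" for b m n
    using that by (induction n rule: dec_induct) (use P_sub br_Suc in fastforce)+
  \<comment> \<open>Coordinate \<open>i\<close> is read at depth \<open>i + 2\<close>, because a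
    node at that depth is constant on the coordinates below \<open>i + 1\<close>.\<close>
  define s where "s b i = w (pt (br b (Suc (Suc i)))) i" for b i
  define u where "u b i = h (pt (br b (Suc (Suc i)))) i" for b i
  have su: "s b i = w x i \<and> u b i = h x i" if "x \<in> P (br b n)" "i + 2 \<le> n" for b i n x
  proof -
    have "x \<in> P (br b (Suc (Suc i)))" using br_mono[of "Suc (Suc i)" n b] that by auto
    then show ?thesis unfolding s_def u_def
      using P_eq[of "pt (br b (Suc (Suc i)))" "b (Suc i)" "br b (Suc i)" x i]
        pt[of "br b (Suc (Suc i))"] br_Suc[of b "Suc i"] br_len[of b "Suc i"] by simp
  qed
  have "(s b, u b) \<in> C" for b
  proof (rule seq_closedD[OF C(1)])
    fix n
    let ?x = "pt (br b (n + 2))"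
    have "?x \<in> A" using pt P by blast
    then have "(w ?x, h ?x) \<in> C" by (rule h)
    moreover have "\<forall>i<n. w ?x i = s b i \<and> h ?x i = u b i"
      using su[OF pt[of "br b (n + 2)"]] by simp
    ultimately show "\<exists>s' u'. (s', u') \<in> C \<and> (\<forall>i<n. s' i = s b i \<and> u' i = u b i)" by blast
  qed
  then have "s b \<in> N" for b unfolding C(2) by force
  then have "\<exists>x\<in>J. s b = w x" for b using N(2) by blast
  then obtain X where X: "\<And>b. X b \<in> J" "\<And>b. s b = w (X b)" by metis
  \<comment> \<open>Every branch limit is some \<open>w x\<close> with entries in \<open>C0\<close>,
    so \<open>cnt\<close> permits only countably many indices \<open>X b\<close>.\<close>
  have "range (w (X b)) \<subseteq> C0" for b
    unfolding X(2)[symmetric] C0_def s_def by auto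
  then have "range X \<subseteq> {x \<in> J. range (w x) \<subseteq> C0}" using X(1) by auto
  then have cX: "countable (range X)" using cnt[OF C0] countable_subset by blast
  have "inj s"
  proof (rule injI, rule ccontr)
    fix b c :: "nat \<Rightarrow> bool" assume eq: "s b = s c" and "b \<noteq> c"
    then have "\<exists>n. b n \<noteq> c n" by auto
    then obtain n where n: "b n \<noteq> c n" "\<And>i. i < n \<Longrightarrow> b i = c i"
      using exists_least_iff[of "\<lambda>n. b n \<noteq> c n"] by blast
    have "br b n = br c n" using n(2) by (simp add: br_def)
    moreover obtain m where m: "\<forall>x\<in>P (True # br b n). \<forall>y\<in>P (False # br b n). w x m \<noteq> w y m"
      using P_split by blast
    \<comment> \<open>Deep enough to lie beyond the split at depth \<open>Suc n\<close> and to have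
      settled coordinate \<open>m\<close>.\<close>
    moreover define K where "K = Suc n + m + 2"
    have "pt (br b K) \<in> P (br b (Suc n))" "pt (br c K) \<in> P (br c (Suc n))"
      using pt br_mono[of "Suc n" K] by (auto simp: K_def)
    ultimately have "w (pt (br b K)) m \<noteq> w (pt (br c K)) m"
      using n(1) by (cases "b n"; cases "c n"; simp add: br_Suc; metis)
    moreover have "s b m = w (pt (br b K)) m" "s c m = w (pt (br c K)) m"
      using su[OF pt[of "br b K"], of m] su[OF pt[of "br c K"], of m] by (auto simp: K_def)
    ultimately show False using eq by simp
  qed
  then have "inj X" using X(2) by (metis injD injI)
  then have "countable (UNIV :: (nat \<Rightarrow> bool) set)"
    using cX countable_image_inj_eq by blast
  then obtain f :: "nat \<Rightarrow> nat \<Rightarrow> bool" where "surj f"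
    by (metis uncountable_def UNIV_not_empty)
  then obtain n where "f n = (\<lambda>i. \<not> f i i)" by (metis surjD)
  then show False by metis
qed

section \<open>Enumerated segments of a well-order\<close>

text \<open>Well-order \<open>I\<close>. If some point has uncountably many predecessors, the
  predecessors of the least such point form \<open>J\<close>; otherwise \<open>I\<close> itself
  serves. Either way \<open>J\<close> has order type \<open>\<omega>\<^sub>1\<close>.\<close>

lemma uncountable_omega1_subset:
  fixes I :: "'a set"
  assumes "uncountable I"
  obtains J and r :: "('a \<times> 'a) set" where "J \<subseteq> I" "uncountable J" "wf r"
    "\<And>x y. x \<in> J \<Longrightarrow> y \<in> J \<Longrightarrow> x \<noteq> y \<Longrightarrow> (x, y) \<in> r \<or> (y, x) \<in> r"
    "\<And>x. x \<in> J \<Longrightarrow> countable {y \<in> J. (y, x) \<in> r}"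
proof -
  obtain r0 where r0: "well_order_on I r0" using well_order_on by blast
  define r where "r = r0 - Id"
  have wf: "wf r" using r0 by (simp add: r_def well_order_on_def)
  have "total_on I r0" "r0 \<subseteq> I \<times> I"
    using r0 by (auto simp: well_order_on_def linear_order_on_def partial_order_on_def
        preorder_on_def)
  then have tot: "\<And>x y. x \<in> I \<Longrightarrow> y \<in> I \<Longrightarrow> x \<noteq> y \<Longrightarrow> (x, y) \<in> r \<or> (y, x) \<in> r"
    and field: "\<And>x y. (x, y) \<in> r \<Longrightarrow> x \<in> I \<and> y \<in> I"
    unfolding r_def by (auto simp: total_on_def)
  show thesis
  proof (cases "\<exists>x. uncountable {y. (y, x) \<in> r}")
    case False
    then have "countable {y \<in> I. (y, x) \<in> r}" for x
      by (metis (no_types, lifting) countable_subset mem_Collect_eq subsetI)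
    then show thesis by (intro that[of I r] assms wf tot) auto
  next
    case True
    then obtain x0 where "x0 \<in> {x. uncountable {y. (y, x) \<in> r}}" by blast
    then obtain x where "x \<in> {x. uncountable {y. (y, x) \<in> r}}"
        "\<And>z. (z, x) \<in> r \<Longrightarrow> z \<notin> {x. uncountable {y. (y, x) \<in> r}}"
      by (rule wfE_min[OF wf]) (rule that)
    then have x: "uncountable {y. (y, x) \<in> r}"
        "\<And>z. (z, x) \<in> r \<Longrightarrow> countable {y. (y, z) \<in> r}" by simp_all
    have "countable {y \<in> {y. (y, x) \<in> r}. (y, z) \<in> r}" if "z \<in> {y. (y, x) \<in> r}" for z
      by (rule countable_subset[OF _ x(2)[of z]]) (use that in auto)
    moreover have I: "{y. (y, x) \<in> r} \<subseteq> I" using field by blast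
    moreover have "(y, z) \<in> r \<or> (z, y) \<in> r"
      if "y \<in> {y. (y, x) \<in> r}" "z \<in> {y. (y, x) \<in> r}" "y \<noteq> z" for y z
      using tot I that by (meson subsetD)
    ultimately show thesis
      by (intro that[of "{y. (y, x) \<in> r}" r] x(1) wf)
  qed
qed

text \<open>A countable family of sets on which some \<open>w x\<close> restricted to \<open>k\<close> is countable-to-one
  cannot cover \<open>J\<close>: the least index \<open>x\<close> outside a countable initial segment closed under
  the family would have to lie in that segment.\<close>

lemma enumerated_segments:
  fixes I :: "'a set"
  assumes "uncountable I"
  obtains J and w :: "'a \<Rightarrow> nat \<Rightarrow> 'a" where "J \<subseteq> I"
    "\<And>C. countable C \<Longrightarrow> countable {x \<in> J. range (w x) \<subseteq> C}"
    "\<not> sigma_thin w J"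
proof -
  obtain J r where J: "J \<subseteq> I" "uncountable J" "wf r"
    "\<And>x y. x \<in> J \<Longrightarrow> y \<in> J \<Longrightarrow> x \<noteq> y \<Longrightarrow> (x, y) \<in> r \<or> (y, x) \<in> r"
    "\<And>x. x \<in> J \<Longrightarrow> countable {y \<in> J. (y, x) \<in> r}"
    by (rule uncountable_omega1_subset[OF assms]) (rule that)
  obtain bot where bot: "bot \<in> J" using J(2) by fastforce
  \<comment> \<open>Adding \<open>bot\<close> keeps each segment non-empty, so that
    \<open>from_nat_into\<close> enumerates it.\<close>
  define seg where "seg x = insert bot {y \<in> J. (y, x) \<in> r}" for x
  define w where "w x = from_nat_into (seg x)" for x
  have range_w: "range (w x) = seg x" if "x \<in> J" for x
    unfolding w_def by (rule range_from_nat_into) (use J(5)[OF that] in \<open>auto simp: seg_def\<close>)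
  have cnt: "countable {x \<in> J. range (w x) \<subseteq> C}" if C: "countable C" for C
  proof -
    have "\<not> J \<subseteq> C" using C J(2) countable_subset by blast
    then obtain x where x: "x \<in> J" "x \<notin> C" by blast
    \<comment> \<open>Any \<open>y\<close> above \<open>x\<close> lists \<open>x\<close>, which is
      outside \<open>C\<close>; this leaves only \<open>x\<close> and its predecessors.\<close>
    have "{y \<in> J. range (w y) \<subseteq> C} \<subseteq> insert x {y \<in> J. (y, x) \<in> r}"
    proof
      fix y assume "y \<in> {y \<in> J. range (w y) \<subseteq> C}"
      then have y: "y \<in> J" "seg y \<subseteq> C" using range_w by auto
      then have "(x, y) \<notin> r" using x by (auto simp: seg_def)
      then show "y \<in> insert x {y \<in> J. (y, x) \<in> r}" using J(4) x(1) y(1) by blast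
    qed
    then show ?thesis by (rule countable_subset) (simp add: J(5)[OF x(1)])
  qed
  have "\<not> sigma_thin w J"
  proof
    assume "sigma_thin w J"
    then obtain T :: "nat \<Rightarrow> 'a set" where T: "J \<subseteq> (\<Union>n. T n)" "\<forall>n. \<exists>k. thin_at k w (T n)"
      unfolding sigma_thin_def by (elim exE conjE)
    then obtain k where k: "\<And>n. thin_at (k n) w (T n)" by metis
    \<comment> \<open>The indices in some \<open>T n\<close> whose prefix of length
      \<open>k n\<close> has entries in \<open>C\<close>. For countable \<open>C\<close> there are
      countably many such prefixes, each shared by countably many indices of
      \<open>T n\<close>.\<close>
    define H where "H C = {x \<in> J. \<exists>n. x \<in> T n \<and> (\<forall>i<k n. w x i \<in> C)}" for C
    define D where "D C = C \<union> H C \<union> {y \<in> J. \<exists>x\<in>H C. (y, x) \<in> r}" for C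
    have "countable (H C)" if C: "countable C" for C
    proof -
      have "countable {l. set l \<subseteq> C}"
        using countable_lists[OF C] by (simp add: lists_eq_set)
      then have "countable (\<Union>n. \<Union>l\<in>{l. set l \<subseteq> C}. {x \<in> T n. \<forall>i<k n. w x i = l ! i})"
        using k unfolding thin_at_def by (intro countable_UN) auto
      moreover have "H C \<subseteq> (\<Union>n. \<Union>l\<in>{l. set l \<subseteq> C}. {x \<in> T n. \<forall>i<k n. w x i = l ! i})"
      proof
        fix x assume "x \<in> H C"
        then obtain n where n: "x \<in> T n" "\<forall>i<k n. w x i \<in> C" unfolding H_def by blast
        then have "set (map (w x) [0..<k n]) \<subseteq> C" by auto
        moreover have "x \<in> {y \<in> T n. \<forall>i<k n. w y i = map (w x) [0..<k n] ! i}"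
          using n(1) by simp
        ultimately show "x \<in> (\<Union>n. \<Union>l\<in>{l. set l \<subseteq> C}. {x \<in> T n. \<forall>i<k n. w x i = l ! i})"
          by blast
      qed
      ultimately show ?thesis by (rule countable_subset[rotated])
    qed
    moreover have "{y \<in> J. \<exists>x\<in>H C. (y, x) \<in> r} = (\<Union>x\<in>H C. {y \<in> J. (y, x) \<in> r})" for C
      by blast
    moreover have "x \<in> J" if "x \<in> H C" for x C using that by (simp add: H_def)
    ultimately have D: "countable (D C)" if "countable C" for C
      using that J(5) unfolding D_def by auto
    \<comment> \<open>The union of these stages is countable and closed under \<open>H\<close>.
      Starting from \<open>bot\<close> puts the whole segment of the least index outside the union
      into the union.\<close>
    define E where "E j = (D ^^ j) {bot}" for j
    have "countable (E j)" for j by (induction j) (simp_all add: E_def D)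
    then have "countable (\<Union>j. E j)" by blast
    then have "\<not> J \<subseteq> (\<Union>j. E j)" using J(2) countable_subset by blast
    then obtain x0 where "x0 \<in> J - (\<Union>j. E j)" by blast
    then obtain x where "x \<in> J - (\<Union>j. E j)"
        "\<And>y. (y, x) \<in> r \<Longrightarrow> y \<notin> J - (\<Union>j. E j)"
      by (rule wfE_min[OF J(3)]) (rule that)
    then have x: "x \<in> J" "x \<notin> (\<Union>j. E j)"
        "\<And>y. (y, x) \<in> r \<Longrightarrow> y \<in> J \<Longrightarrow> y \<in> (\<Union>j. E j)" by blast+
    have "bot \<in> E 0" by (simp add: E_def)
    then have seg: "seg x \<subseteq> (\<Union>j. E j)" using x(3) unfolding seg_def by blast
    have mono: "E i \<subseteq> E j" if "i \<le> j" for i j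
      using that by (induction rule: dec_induct) (auto simp: E_def D_def)
    obtain n where n: "x \<in> T n" using T(1) x(1) by blast
    have "\<forall>i. \<exists>j. w x i \<in> E j" using range_w[OF x(1)] seg by blast
    then obtain f where f: "\<And>i. w x i \<in> E (f i)" by metis
    \<comment> \<open>The finitely many entries below \<open>k n\<close> have all appeared by one
      common stage, so \<open>x\<close> itself is added at the next.\<close>
    have "w x i \<in> E (Max (f ` {..k n}))" if "i < k n" for i
      using f[of i] mono[of "f i" "Max (f ` {..k n})"] that by (auto intro!: Max_ge)
    then have "x \<in> H (E (Max (f ` {..k n})))" unfolding H_def using x(1) n by blast
    then have "x \<in> E (Suc (Max (f ` {..k n})))" by (simp add: E_def D_def)
    then show False using x(2) by blast
  qed
  then show thesis using that[of J w] J(1) cnt by blast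
qed

section \<open>Ultrametrics with values in \<open>R\<close>\<close>

text \<open>This sequence supplies the values of the metric on sequences and the values to which a
  given ultrametric is rounded. The bound \<open>1 / real (Suc n)\<close> in the dependent choice
  forces convergence to 0.\<close>

lemma characteristic_range_set_seq:
  assumes "characteristic_range_set R"
  obtains r :: "nat \<Rightarrow> real" where "decseq r" "\<And>n. r n \<in> R" "\<And>n. 0 < r n"
    "\<forall>t>0. \<exists>n. r n < t"
proof -
  have small: "\<exists>x. x \<in> R \<and> 0 < x \<and> x \<le> t" if t: "0 < t" for t
  proof -
    obtain x where x: "x \<in> R" "x \<noteq> 0" "x \<le> t"
      using assms t unfolding characteristic_range_set_def by blast
    moreover have "0 \<le> x"
      using assms x(1) unfolding characteristic_range_set_def range_set_def by auto
    ultimately show ?thesis by (intro exI[of _ x]) simp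
  qed
  let ?P = "\<lambda>n x. x \<in> R \<and> 0 < x \<and> x \<le> 1 / real (Suc n)"
  have "\<exists>r. \<forall>n. ?P n (r n) \<and> r (Suc n) \<le> r n"
  proof (rule dependent_nat_choice)
    show "\<exists>x. ?P 0 x" using small[of 1] by simp
    fix x n assume "?P n x"
    then have "0 < min x (1 / real (Suc (Suc n)))" by simp
    from small[OF this] show "\<exists>y. ?P (Suc n) y \<and> y \<le> x" by auto
  qed
  then obtain r where r: "\<And>n. ?P n (r n)" "\<And>n. r (Suc n) \<le> r n" by blast
  have "\<exists>n. r n < t" if t: "0 < t" for t
  proof -
    obtain n where "inverse (real (Suc n)) < t" using reals_Archimedean[OF t] by blast
    moreover have "r n \<le> inverse (real (Suc n))" using r(1)[of n] by (simp add: inverse_eq_divide)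
    ultimately show ?thesis by (meson le_less_trans)
  qed
  then show thesis using r by (intro that[of r] decseq_SucI) auto
qed

text \<open>The first-difference metric of Baire space, with \<open>r n\<close> in place of the
  usual \<open>1 / (n + 1)\<close> to keep its values in \<open>R\<close>.\<close>

definition seq_gap :: "(nat \<Rightarrow> real) \<Rightarrow> (nat \<Rightarrow> 'b) \<Rightarrow> (nat \<Rightarrow> 'b) \<Rightarrow> real" where
  "seq_gap r s t = (if s = t then 0 else r (LEAST n. s n \<noteq> t n))"

lemma seq_gap_le:
  assumes "decseq r" "\<And>n. 0 < r n" "\<And>i. i < n \<Longrightarrow> s i = t i"
  shows "seq_gap r s t \<le> r n"
proof (cases "s = t")
  case True
  then show ?thesis using assms(2)[of n] by (simp add: seq_gap_def)
next
  case False
  then have "s (LEAST n. s n \<noteq> t n) \<noteq> t (LEAST n. s n \<noteq> t n)"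
    by (intro LeastI_ex[of "\<lambda>n. s n \<noteq> t n"]) auto
  then have "n \<le> (LEAST n. s n \<noteq> t n)" using assms(3) not_le by blast
  then show ?thesis using False decseqD[OF assms(1)] by (simp add: seq_gap_def)
qed

text \<open>If \<open>s\<close> and \<open>t\<close> agree below \<open>n\<close>, the gap is at
  most \<open>r n\<close>. Otherwise they first differ below \<open>n\<close>, where
  \<open>s\<close> and \<open>s'\<close> agree, so both gaps are equal. The form of the bound
  matches the one in \<open>UD\<close>.\<close>

lemma seq_gap_close:
  assumes "decseq r" "\<And>n. 0 < r n" "\<And>i. i < n \<Longrightarrow> s i = s' i"
  shows "seq_gap r s t \<le> max (seq_gap r s' t) (r n)"
proof (cases "\<forall>i<n. s i = t i")
  case True
  then show ?thesis using seq_gap_le[OF assms(1,2), of n s t] by simp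
next
  case False
  then obtain m where m: "m < n" "s m \<noteq> t m" by blast
  define l where "l = (LEAST n. s n \<noteq> t n)"
  have l: "s l \<noteq> t l" "\<And>i. i < l \<Longrightarrow> s i = t i"
    unfolding l_def by (rule LeastI[of "\<lambda>n. s n \<noteq> t n", OF m(2)]) (use not_less_Least in blast)
  have "l \<le> m" unfolding l_def by (rule Least_le[of "\<lambda>n. s n \<noteq> t n", OF m(2)])
  then have "(LEAST n. s' n \<noteq> t n) = l"
    using l m(1) assms(3) by (intro Least_equality) (auto simp: not_less[symmetric])
  moreover have "s' \<noteq> t" "s \<noteq> t" using l(1) \<open>l \<le> m\<close> m(1) assms(3)[of l] by auto
  ultimately show ?thesis unfolding seq_gap_def l_def[symmetric] by simp
qed

text \<open>Rounds down to the largest \<open>r k\<close> below \<open>t\<close>: as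
  \<open>r\<close> is decreasing, the least index yields the largest value.\<close>

definition quantize :: "(nat \<Rightarrow> real) \<Rightarrow> real \<Rightarrow> real" where
  "quantize r t = (if t \<le> 0 then 0 else r (LEAST k. r k \<le> t))"

lemma quantize:
  assumes "decseq r" "\<And>n. 0 < r n" "\<forall>t>0. \<exists>n. r n < t"
  shows quantize_mono: "t \<le> u \<Longrightarrow> quantize r t \<le> quantize r u"
    and quantize_le: "0 \<le> t \<Longrightarrow> quantize r t \<le> t"
    and quantize_less: "quantize r t < r k \<Longrightarrow> t < r k"
    and quantize_eq_0: "0 \<le> t \<Longrightarrow> quantize r t = 0 \<longleftrightarrow> t = 0"
    and quantize_nonneg: "0 \<le> quantize r t"
proof -
  have least: "r (LEAST k. r k \<le> t) \<le> t" if "0 < t" for t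
  proof -
    have "\<exists>k. r k < t" using assms(3) that by simp
    then have "\<exists>k. r k \<le> t" by (elim exE) (rule exI, erule less_imp_le)
    then show ?thesis by (rule LeastI_ex[of "\<lambda>k. r k \<le> t"])
  qed
  have le: "r m \<le> quantize r t" if "r m \<le> t" for m t
  proof -
    have "(LEAST k. r k \<le> t) \<le> m" using that by (rule Least_le[of "\<lambda>k. r k \<le> t"])
    then show ?thesis using decseqD[OF assms(1)] that assms(2)[of m] by (simp add: quantize_def)
  qed
  show "0 \<le> quantize r t" using assms(2) by (simp add: quantize_def less_imp_le)
  show "quantize r t \<le> quantize r u" if "t \<le> u"
  proof (cases "0 < t")
    case True
    then show ?thesis
      using le[OF order_trans[OF least[OF True] that]] by (simp add: quantize_def)
  next
    case False
    then show ?thesis using assms(2) by (simp add: quantize_def less_imp_le)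
  qed
  show "quantize r t \<le> t" if "0 \<le> t" using least[of t] that by (simp add: quantize_def)
  show "t < r k" if "quantize r t < r k" using le[of k t] that by linarith
  show "quantize r t = 0 \<longleftrightarrow> t = 0" if "0 \<le> t"
    using that assms(2)[of "LEAST k. r k \<le> t"] by (auto simp: quantize_def)
qed

text \<open>The radius \<open>\<delta>\<close> may depend on \<open>x\<close>. This matters for
  glued functions, where each class has its own size.\<close>

lemma induces_topology_equivalent:
  assumes d: "induces_topology d X" and e: "Metric_space (topspace X) e"
    and de: "\<And>x \<epsilon>. x \<in> topspace X \<Longrightarrow> 0 < \<epsilon> \<Longrightarrow> \<exists>\<delta>>0. \<forall>y\<in>topspace X. d x y < \<delta> \<longrightarrow> e x y < \<epsilon>"
    and ed: "\<And>x \<epsilon>. x \<in> topspace X \<Longrightarrow> 0 < \<epsilon> \<Longrightarrow> \<exists>\<delta>>0. \<forall>y\<in>topspace X. e x y < \<delta> \<longrightarrow> d x y < \<epsilon>"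
  shows "induces_topology e X"
proof -
  interpret D: Metric_space "topspace X" d using d by (simp add: induces_topology_def)
  interpret E: Metric_space "topspace X" e by (rule e)
  have D: "D.mtopology = X" using d by (simp add: induces_topology_def)
  have "\<exists>\<delta>>0. D.mball x \<delta> \<subseteq> E.mball x \<epsilon>" if x: "x \<in> topspace X" and \<epsilon>: "0 < \<epsilon>" for x \<epsilon>
  proof -
    obtain \<delta> where "\<delta> > 0" "\<forall>y\<in>topspace X. d x y < \<delta> \<longrightarrow> e x y < \<epsilon>" using de[OF x \<epsilon>] by blast
    then show ?thesis using x by (intro exI[of _ \<delta>]) auto
  qed
  moreover have "\<exists>\<delta>>0. E.mball x \<delta> \<subseteq> D.mball x \<epsilon>" if x: "x \<in> topspace X" and \<epsilon>: "0 < \<epsilon>" for x \<epsilon>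
  proof -
    obtain \<delta> where "\<delta> > 0" "\<forall>y\<in>topspace X. e x y < \<delta> \<longrightarrow> d x y < \<epsilon>" using ed[OF x \<epsilon>] by blast
    then show ?thesis using x by (intro exI[of _ \<delta>]) auto
  qed
  ultimately have "openin E.mtopology U \<longleftrightarrow> openin D.mtopology U" for U
    unfolding E.openin_mtopology D.openin_mtopology by (meson subset_iff)
  then have "E.mtopology = D.mtopology" by (simp add: topology_eq)
  then show ?thesis using D e by (simp add: induces_topology_def)
qed

lemma Metric_space_ultraI:
  assumes "\<And>x y. 0 \<le> d x y" "\<And>x y. d x y = d y x"
    "\<And>x y. x \<in> M \<Longrightarrow> y \<in> M \<Longrightarrow> d x y = 0 \<longleftrightarrow> x = y" "ultra_triangle_on M d"
  shows "Metric_space M d"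
proof
  fix x y z assume xyz: "x \<in> M" "y \<in> M" "z \<in> M"
  then have "d x z \<le> max (d x y) (d y z)" using assms(4) unfolding ultra_triangle_on_def by blast
  also have "\<dots> \<le> d x y + d y z" using assms(1)[of x y] assms(1)[of y z] by simp
  finally show "d x z \<le> d x y + d y z" .
qed (use assms in auto)

text \<open>Rounding a compatible ultrametric down into \<open>R\<close> is monotone, hence keeps
  the strong triangle inequality; \<open>quantize_le\<close> and \<open>quantize_less\<close>
  compare the small balls.\<close>

lemma range_valued_ultrametric:
  assumes R: "characteristic_range_set R" and X: "ultrametrizable_space X"
  obtains \<rho> where "ultra_triangle_on (topspace X) \<rho>" "induces_topology \<rho> X" "\<And>x y. \<rho> x y \<in> R"
proof -
  obtain r where r: "decseq r" "\<And>n. r n \<in> R" "\<And>n. 0 < r n" "\<forall>t>0. \<exists>n. r n < t"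
    by (rule characteristic_range_set_seq[OF R]) (rule that)
  obtain d where d: "ultra_triangle_on (topspace X) d" "induces_topology d X"
    using X unfolding ultrametrizable_space_def by blast
  interpret D: Metric_space "topspace X" d using d(2) by (simp add: induces_topology_def)
  note q = quantize[OF r(1,3,4)]
  define \<rho> where "\<rho> x y = quantize r (d x y)" for x y
  have ultra: "ultra_triangle_on (topspace X) \<rho>"
    unfolding ultra_triangle_on_def
  proof (intro ballI)
    fix x y z assume "x \<in> topspace X" "y \<in> topspace X" "z \<in> topspace X"
    then have "d x z \<le> max (d x y) (d y z)" using d(1) unfolding ultra_triangle_on_def by blast
    then have "d x z \<le> d x y \<or> d x z \<le> d y z" by (simp add: le_max_iff_disj)
    then show "\<rho> x z \<le> max (\<rho> x y) (\<rho> y z)"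
      unfolding \<rho>_def le_max_iff_disj using q(1) by blast
  qed
  have "Metric_space (topspace X) \<rho>"
    by (rule Metric_space_ultraI[OF _ _ _ ultra]) (use q(4,5) D.commute in \<open>auto simp: \<rho>_def\<close>)
  moreover have "\<exists>\<delta>>0. \<forall>y\<in>topspace X. d x y < \<delta> \<longrightarrow> \<rho> x y < \<epsilon>" if "0 < \<epsilon>" for x \<epsilon>
    using that q(2)[OF D.nonneg] unfolding \<rho>_def by (meson le_less_trans)
  moreover have "\<exists>\<delta>>0. \<forall>y\<in>topspace X. \<rho> x y < \<delta> \<longrightarrow> d x y < \<epsilon>" if \<epsilon>: "0 < \<epsilon>" for x \<epsilon>
  proof -
    obtain n where "r n < \<epsilon>" using r(4) \<epsilon> by blast
    then show ?thesis
      using r(3)[of n] q(3)[of _ n] by (intro exI[of _ "r n"]) (auto simp: \<rho>_def intro: less_trans)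
  qed
  ultimately have "induces_topology \<rho> X"
    by (rule induces_topology_equivalent[OF d(2)])
  moreover have "\<rho> x y \<in> R" for x y
    using R r(2) by (auto simp: \<rho>_def quantize_def characteristic_range_set_def range_set_def)
  ultimately show thesis using ultra by (intro that)
qed

text \<open>If for every radius \<open>1 / real (Suc n)\<close> there were only countably many
  representatives, together they would form a countable dense set.\<close>

lemma uncountable_ball_partition:
  assumes \<rho>: "ultra_triangle_on (topspace X) \<rho>" "induces_topology \<rho> X" and "\<not> separable_space X"
  obtains \<epsilon> p where "0 < \<epsilon>" "\<And>x. x \<in> topspace X \<Longrightarrow> p x \<in> topspace X"
    "\<And>x. x \<in> topspace X \<Longrightarrow> \<rho> x (p x) < \<epsilon>"
    "\<And>x y. x \<in> topspace X \<Longrightarrow> y \<in> topspace X \<Longrightarrow> p x = p y \<longleftrightarrow> \<rho> x y < \<epsilon>"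
    "uncountable (p ` topspace X)"
proof -
  define M where "M = topspace X"
  interpret Metric_space M \<rho> using \<rho>(2) by (simp add: induces_topology_def M_def)
  have top: "mtopology = X" using \<rho>(2) by (simp add: induces_topology_def M_def)
  have tri: "\<rho> x z < \<epsilon>" if "x \<in> M" "y \<in> M" "z \<in> M" "\<rho> x y < \<epsilon>" "\<rho> y z < \<epsilon>" for x y z \<epsilon>
  proof -
    have "\<rho> x z \<le> max (\<rho> x y) (\<rho> y z)"
      using \<rho>(1) that(1-3) unfolding ultra_triangle_on_def M_def by blast
    then show ?thesis using that(4,5) by linarith
  qed
  define p where "p \<epsilon> x = (SOME y. y \<in> M \<and> \<rho> x y < \<epsilon>)" for \<epsilon> x
  have p: "p \<epsilon> x \<in> M \<and> \<rho> x (p \<epsilon> x) < \<epsilon>" if "x \<in> M" "0 < \<epsilon>" for x \<epsilon>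
    unfolding p_def by (rule someI[of _ x]) (use that in auto)
  have eq: "p \<epsilon> x = p \<epsilon> y \<longleftrightarrow> \<rho> x y < \<epsilon>" if "x \<in> M" "y \<in> M" "0 < \<epsilon>" for x y \<epsilon>
  proof
    assume "p \<epsilon> x = p \<epsilon> y"
    then show "\<rho> x y < \<epsilon>"
      using p[OF that(1,3)] p[OF that(2,3)] tri[of x "p \<epsilon> x" y \<epsilon>] that commute[of y] by simp
  next
    assume "\<rho> x y < \<epsilon>"
    \<comment> \<open>The two balls coincide, so \<open>SOME\<close> is applied to the same
      predicate and returns the same representative.\<close>
    then have "y' \<in> M \<and> \<rho> x y' < \<epsilon> \<longleftrightarrow> y' \<in> M \<and> \<rho> y y' < \<epsilon>" for y'
      using tri[of x y y' \<epsilon>] tri[of y x y' \<epsilon>] that(1,2) commute[of x y] by auto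
    then show "p \<epsilon> x = p \<epsilon> y" unfolding p_def by simp
  qed
  have "\<exists>n. uncountable (p (1 / real (Suc n)) ` M)"
  proof (rule ccontr)
    assume neg: "\<not> ?thesis"
    define C where "C = (\<Union>n. p (1 / real (Suc n)) ` M)"
    have C: "countable C" unfolding C_def using neg by (intro countable_UN) auto
    have CM: "C \<subseteq> M" unfolding C_def using p by auto
    have "mtopology closure_of C = M"
      unfolding metric_closure_of
    proof (intro equalityI subsetI CollectI conjI allI impI)
      fix x \<epsilon> assume x: "x \<in> M" and "(0::real) < \<epsilon>"
      then obtain n where n: "inverse (real (Suc n)) < \<epsilon>" using reals_Archimedean by blast
      have "p (1 / real (Suc n)) x \<in> C" using x unfolding C_def by blast
      moreover have "p (1 / real (Suc n)) x \<in> mball x \<epsilon>"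
        using p[OF x, of "1 / real (Suc n)"] n x by (simp add: inverse_eq_divide)
      ultimately show "\<exists>y\<in>C. y \<in> mball x \<epsilon>" by blast
    qed auto
    then have "separable_space X"
      unfolding separable_space_def using C CM top M_def by blast
    then show False using assms(3) by simp
  qed
  then obtain n where "uncountable (p (1 / real (Suc n)) ` M)" by blast
  then show thesis
    using p eq by (intro that[of "1 / real (Suc n)" "p (1 / real (Suc n))"]) (simp_all add: M_def)
qed

section \<open>Resizing the classes of a partition\<close>

text \<open>An ultrametric hedgehog: a class with representative \<open>i\<close> is truncated to
  size \<open>f i\<close> and placed at distance \<open>f i\<close> from an ideal centre. Size 0
  collapses the class to a point.\<close>

definition glue :: "'a set \<Rightarrow> ('a \<Rightarrow> 'a \<Rightarrow> real) \<Rightarrow> ('a \<Rightarrow> 'a) \<Rightarrow> ('a \<Rightarrow> real) \<Rightarrow> 'a \<Rightarrow> 'a \<Rightarrow> real" where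
  "glue M \<rho> p f x y = (if x \<in> M \<and> y \<in> M
     then if p x = p y then min (\<rho> x y) (f (p x)) else max (f (p x)) (f (p y)) else 0)"

locale partitioned_ultrametric =
  fixes R :: "real set" and Y :: "'a topology" and \<rho> and p :: "'a \<Rightarrow> 'a" and \<epsilon> :: real
  assumes range_set: "range_set R"
    and ultra: "ultra_triangle_on (topspace Y) \<rho>"
    and induces: "induces_topology \<rho> Y"
    and \<rho>_in: "\<And>x y. \<rho> x y \<in> R"
    and eps_pos: "0 < \<epsilon>"
    and p_in: "\<And>x. x \<in> topspace Y \<Longrightarrow> p x \<in> topspace Y"
    and p_near: "\<And>x. x \<in> topspace Y \<Longrightarrow> \<rho> x (p x) < \<epsilon>"
    and p_eq_iff: "\<And>x y. x \<in> topspace Y \<Longrightarrow> y \<in> topspace Y \<Longrightarrow> p x = p y \<longleftrightarrow> \<rho> x y < \<epsilon>"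
begin

sublocale Metric_space "topspace Y" \<rho>
  using induces by (simp add: induces_topology_def)

lemma mtopology_eq: "mtopology = Y"
  using induces by (simp add: induces_topology_def)

abbreviation glued :: "('a \<Rightarrow> real) \<Rightarrow> 'a \<Rightarrow> 'a \<Rightarrow> real" where
  "glued \<equiv> glue (topspace Y) \<rho> p"

lemma glued_nonneg: "(\<And>i. 0 \<le> f i) \<Longrightarrow> 0 \<le> glued f x y"
  by (simp add: glue_def le_max_iff_disj)

lemma glued_commute: "glued f x y = glued f y x"
  by (auto simp: glue_def commute max.commute)

lemma glued_refl: "(\<And>i. 0 \<le> f i) \<Longrightarrow> glued f x x = 0"
  by (simp add: glue_def min_def)

lemma glued_in: "(\<And>i. f i \<in> R) \<Longrightarrow> glued f x y \<in> R"
  using range_set \<rho>_in by (simp add: glue_def min_def max_def range_set_def)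

lemma glued_le: "x \<in> topspace Y \<Longrightarrow> y \<in> topspace Y \<Longrightarrow> \<rho> x y < \<epsilon> \<Longrightarrow> glued f x y \<le> \<rho> x y"
  using p_eq_iff[of x y] by (simp add: glue_def)

text \<open>Truncation by a constant is harmless inside one class. If only \<open>y\<close> lies in
  another class, the left side is at most \<open>f (p x)\<close>, which the right side
  dominates.\<close>

lemma glued_ultra:
  assumes "\<And>i. 0 \<le> f i"
  shows "ultra_triangle_on (topspace Y) (glued f)"
  unfolding ultra_triangle_on_def
proof (intro ballI)
  fix x y z assume xyz: "x \<in> topspace Y" "y \<in> topspace Y" "z \<in> topspace Y"
  then have "\<rho> x z \<le> max (\<rho> x y) (\<rho> y z)" using ultra unfolding ultra_triangle_on_def by blast
  then have "\<rho> x z \<le> \<rho> x y \<or> \<rho> x z \<le> \<rho> y z" by (simp add: le_max_iff_disj)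
  then show "glued f x z \<le> max (glued f x y) (glued f y z)"
    using xyz assms[of "p x"] assms[of "p y"] assms[of "p z"]
    by (cases "p x = p y"; cases "p y = p z"; cases "p x = p z")
      (auto simp: glue_def min_le_iff_disj le_max_iff_disj)
qed

lemma glued_continuous:
  assumes f: "\<And>i. 0 \<le> f i"
  shows "continuous_map (prod_topology Y Y) (top_of_set {0..}) (\<lambda>(x, y). glued f x y)"
proof -
  have "continuous_map (prod_topology Y Y) Met_TC.mtopology (\<lambda>(x, y). glued f x y)"
    unfolding Met_TC.continuous_map_to_metric
  proof (intro ballI allI impI)
    fix z and e :: real assume z: "z \<in> topspace (prod_topology Y Y)" and e: "0 < e"
    obtain x y where xy: "z = (x, y)" "x \<in> topspace Y" "y \<in> topspace Y" using z by auto
    \<comment> \<open>The bound \<open>\<epsilon>\<close> keeps nearby points in one class, where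
      \<open>glued_le\<close> applies; \<open>e / 2\<close> makes the final estimate strict.\<close>
    define \<eta> where "\<eta> = min \<epsilon> (e / 2)"
    have \<eta>: "0 < \<eta>" "\<eta> \<le> \<epsilon>" "\<eta> < e" using e eps_pos by (auto simp: \<eta>_def min_def)
    let ?U = "mball x \<eta> \<times> mball y \<eta>"
    have tri: "glued f a c \<le> max (glued f a b) (glued f b c)"
      if "a \<in> topspace Y" "b \<in> topspace Y" "c \<in> topspace Y" for a b c
      using glued_ultra[of f, OF f] that unfolding ultra_triangle_on_def by blast
    have "openin (prod_topology Y Y) ?U"
      using openin_mball[of x \<eta>] openin_mball[of y \<eta>] by (simp add: openin_prod_Times_iff mtopology_eq)
    moreover have "z \<in> ?U" using xy \<eta>(1) by simp
    moreover have "(\<lambda>(x, y). glued f x y) w \<in> Met_TC.mball ((\<lambda>(x, y). glued f x y) z) e"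
      if w: "w \<in> ?U" for w
    proof -
      obtain x' y' where w': "w = (x', y')" "x' \<in> topspace Y" "y' \<in> topspace Y"
          "\<rho> x x' < \<eta>" "\<rho> y y' < \<eta>" using w by auto
      have x: "glued f x x' < \<eta>" and y: "glued f y y' < \<eta>"
        using glued_le[of x x' f] glued_le[of y y' f] w' xy(2,3) \<eta>(2) by auto
      have "glued f x' y' \<le> max (glued f x y) \<eta>"
        using tri[of x' x y'] tri[of x y y'] w'(2,3) xy(2,3) x y glued_commute[of f x x'] by linarith
      moreover have "glued f x y \<le> max (glued f x' y') \<eta>"
        using tri[of x x' y] tri[of x' y' y] w'(2,3) xy(2,3) x y glued_commute[of f y y'] by linarith
      ultimately have "\<bar>glued f x y - glued f x' y'\<bar> < e"
        using glued_nonneg[of f, OF f, of x y] glued_nonneg[of f, OF f, of x' y'] \<eta>(1,3) by linarith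
      then show ?thesis by (simp add: xy(1) w'(1) dist_real_def)
    qed
    ultimately show "\<exists>U. openin (prod_topology Y Y) U \<and> z \<in> U \<and>
        (\<forall>w\<in>U. (\<lambda>(x, y). glued f x y) w \<in> Met_TC.mball ((\<lambda>(x, y). glued f x y) z) e)"
      by blast
  qed
  then show ?thesis
    using glued_nonneg[of f, OF f] by (auto simp: continuous_map_in_subtopology)
qed

lemma glued_in_UCPM:
  assumes "\<And>i. f i \<in> R"
  shows "glued f \<in> UCPM Y R"
proof -
  have f: "0 \<le> f i" for i using assms[of i] range_set by (auto simp: range_set_def)
  show ?thesis
    unfolding UCPM_def mem_Collect_eq
  proof (intro conjI allI ballI impI)
    show "glued f x y = 0" if "x \<notin> topspace Y \<or> y \<notin> topspace Y" for x y
      using that by (auto simp: glue_def)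
    show "glued f x y = glued f y x" for x y by (rule glued_commute)
  qed (simp_all add: glued_continuous glued_refl glued_ultra glued_in f assms)
qed

text \<open>Below the value \<open>f (p x)\<close>, points near \<open>x\<close> lie in its class
  and the glued function equals \<open>\<rho>\<close>. The radius depends on \<open>x\<close>, so
  the sizes of the classes may be arbitrarily small.\<close>

lemma glued_in_UMet:
  assumes fR: "\<And>i. f i \<in> R" and pos: "\<And>i. 0 < f i"
  shows "glued f \<in> UMet Y R"
proof -
  have f: "0 \<le> f i" for i using pos[of i] by simp
  have zero: "glued f x y = 0 \<longleftrightarrow> x = y" if "x \<in> topspace Y" "y \<in> topspace Y" for x y
    using that pos[of "p x"] pos[of "p y"] zero[of x y] by (auto simp: glue_def min_def max_def)
  have "Metric_space (topspace Y) (glued f)"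
    using glued_nonneg[of f, OF f] glued_commute zero glued_ultra[of f, OF f] by (rule Metric_space_ultraI)
  moreover have "\<exists>\<delta>>0. \<forall>y\<in>topspace Y. \<rho> x y < \<delta> \<longrightarrow> glued f x y < e"
    if "x \<in> topspace Y" "0 < e" for x e
  proof (intro exI[of _ "min \<epsilon> e"] conjI ballI impI)
    show "0 < min \<epsilon> e" using that eps_pos by simp
    fix y assume "y \<in> topspace Y" "\<rho> x y < min \<epsilon> e"
    then show "glued f x y < e" using glued_le[OF that(1), of y f] by simp
  qed
  moreover have "\<exists>\<delta>>0. \<forall>y\<in>topspace Y. glued f x y < \<delta> \<longrightarrow> \<rho> x y < e"
    if "x \<in> topspace Y" "0 < e" for x e
  proof (intro exI[of _ "min (f (p x)) e"] conjI ballI impI)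
    show "0 < min (f (p x)) e" using that pos by simp
    fix y assume "y \<in> topspace Y" "glued f x y < min (f (p x)) e"
    then show "\<rho> x y < e" using that(1) by (auto simp: glue_def min_less_iff_disj split: if_splits)
  qed
  ultimately have "induces_topology (glued f) Y"
    by (rule induces_topology_equivalent[OF induces])
  then show ?thesis using glued_in_UCPM[OF fR] by (simp add: UMet_def)
qed

lemma p_idem: "x \<in> topspace Y \<Longrightarrow> p (p x) = p x"
  using p_eq_iff[of x "p x"] p_in p_near by simp

text \<open>The class of \<open>x\<close> is open in \<open>Y\<close>, but every ball of the glued function around \<open>x\<close>
  leaves it.\<close>

lemma glued_not_in_UMet:
  assumes x: "x \<in> p ` topspace Y" "f x = 0"
    and lim: "\<And>e. 0 < e \<Longrightarrow> \<exists>y\<in>p ` topspace Y. y \<noteq> x \<and> 0 \<le> f y \<and> f y < e"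
  shows "glued f \<notin> UMet Y R"
proof
  assume "glued f \<in> UMet Y R"
  then have ind: "induces_topology (glued f) Y" by (simp add: UMet_def)
  interpret G: Metric_space "topspace Y" "glued f" using ind by (simp add: induces_topology_def)
  have G: "G.mtopology = Y" using ind by (simp add: induces_topology_def)
  have xY: "x \<in> topspace Y" "p x = x" using x(1) p_in p_idem by auto
  have "openin G.mtopology (mball x \<epsilon>)" using openin_mball mtopology_eq G by simp
  moreover have "x \<in> mball x \<epsilon>" using xY eps_pos by simp
  ultimately obtain e where e: "0 < e" "G.mball x e \<subseteq> mball x \<epsilon>"
    unfolding G.openin_mtopology by blast
  obtain y where y: "y \<in> p ` topspace Y" "y \<noteq> x" "0 \<le> f y" "f y < e" using lim[OF e(1)] by blast
  have yY: "y \<in> topspace Y" "p y = y" using y(1) p_in p_idem by auto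
  have "y \<in> G.mball x e" using xY yY y(2-4) x(2) e(1) by (simp add: glue_def)
  then have "\<rho> x y < \<epsilon>" using e(2) by auto
  then show False using p_eq_iff[OF xY(1) yY(1)] xY yY y(2) by simp
qed

text \<open>Makes \<open>glued\<close> non-expanding in \<open>f\<close>: it is built from
  \<open>min\<close> and \<open>max\<close>, which preserve bounds of the form
  \<open>a \<le> max b c\<close>. The infimum in \<open>UD\<close> ranges over \<open>R\<close>,
  hence \<open>c \<in> R\<close>.\<close>

lemma UD_glued_le:
  assumes c: "c \<in> R" and f: "\<And>i. 0 \<le> f i" "\<And>i. 0 \<le> g i"
    and fg: "\<And>i. f i \<le> max (g i) c" "\<And>i. g i \<le> max (f i) c"
  shows "UD Y R (glued f) (glued g) \<le> ennreal c"
proof -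
  have c0: "0 \<le> c" using c range_set by (auto simp: range_set_def)
  have le: "ennreal (glued f x y) \<le> max (ennreal (glued g x y)) (ennreal c)"
    if "\<And>i. f i \<le> max (g i) c" for f g :: "'a \<Rightarrow> real" and x y
  proof -
    have "glued f x y \<le> max (glued g x y) c"
      using that[of "p x"] that[of "p y"] c0
      by (auto simp: glue_def le_max_iff_disj min_le_iff_disj)
    then have "glued f x y \<le> glued g x y \<or> glued f x y \<le> c" by (simp add: le_max_iff_disj)
    then show ?thesis by (auto simp: le_max_iff_disj intro: ennreal_leI)
  qed
  show ?thesis
    unfolding UD_def by (rule Inf_lower) (use c le[of f g] le[of g f] fg in auto)
qed

end

section \<open>Pulling \<open>UMet Y R\<close> back to sequences\<close>

theorem theorem3p14:
  fixes R :: "real set" and Y :: "'a topology"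
  assumes "characteristic_range_set R"
    and "ultrametrizable_space Y"
    and "borel_in (UCPM_topology Y R) (UMet Y R)"
  shows "separable_space Y"
proof (rule ccontr)
  assume nonsep: "\<not> separable_space Y"
  obtain r where r: "decseq r" "\<And>n. r n \<in> R" "\<And>n. 0 < r n" "\<forall>t>0. \<exists>n. r n < t"
    by (rule characteristic_range_set_seq[OF assms(1)]) (rule that)
  obtain \<rho> where \<rho>: "ultra_triangle_on (topspace Y) \<rho>" "induces_topology \<rho> Y" "\<And>x y. \<rho> x y \<in> R"
    by (rule range_valued_ultrametric[OF assms(1,2)]) (rule that)
  obtain \<epsilon> p where p: "0 < \<epsilon>" "\<And>x. x \<in> topspace Y \<Longrightarrow> p x \<in> topspace Y"
    "\<And>x. x \<in> topspace Y \<Longrightarrow> \<rho> x (p x) < \<epsilon>"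
    "\<And>x y. x \<in> topspace Y \<Longrightarrow> y \<in> topspace Y \<Longrightarrow> p x = p y \<longleftrightarrow> \<rho> x y < \<epsilon>"
    "uncountable (p ` topspace Y)"
    by (rule uncountable_ball_partition[OF \<rho>(1,2) nonsep]) (rule that)
  have R0: "range_set R" "0 \<in> R"
    using assms(1) by (simp_all add: characteristic_range_set_def range_set_def)
  interpret partitioned_ultrametric R Y \<rho> p \<epsilon>
    by unfold_locales (use R0(1) \<rho> p in auto)
  obtain J and w :: "'a \<Rightarrow> nat \<Rightarrow> 'a" where J: "J \<subseteq> p ` topspace Y" "\<And>C. countable C \<Longrightarrow> countable {x \<in> J. range (w x) \<subseteq> C}"
      "\<not> sigma_thin w J"
    by (rule enumerated_segments[OF p(5)]) (rule that)
  \<comment> \<open>Classes outside \<open>J\<close> get the fixed positive size \<open>r 0\<close>,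
    so only the indices in \<open>J\<close> can produce size 0.\<close>
  define f where "f s i = (if i \<in> J then seq_gap r s (w i) else r 0)" for s i
  have f_in: "f s i \<in> R" and f_nonneg: "0 \<le> f s i" for s i
    using r(2) r(3)[THEN less_imp_le] R0(2) by (simp_all add: f_def seq_gap_def)
  have F_UCPM: "glued (f s) \<in> UCPM Y R" for s by (rule glued_in_UCPM) (rule f_in)
  have f_close: "f s i \<le> max (f s' i) (r n)" if "\<And>i. i < n \<Longrightarrow> s i = s' i" for s s' i n
    using seq_gap_close[OF r(1,3), of n s s' "w i"] that by (simp add: f_def)
  \<comment> \<open>Continuity of the map from \<open>s\<close> to \<open>glued (f s)\<close>: a
    common prefix of length \<open>n\<close> gives \<open>UD\<close> at most
    \<open>r n\<close>.\<close>
  have open_pre: "\<exists>n. {t. \<forall>i<n. t i = s i} \<subseteq> {s. glued (f s) \<in> U}"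
    if U: "openin (UCPM_topology Y R) U" and s: "glued (f s) \<in> U" for U s
  proof -
    obtain q where q: "0 < q" "{e \<in> UCPM Y R. UD Y R (glued (f s)) e < q} \<subseteq> U"
      using U s unfolding openin_UCPM_topology by blast
    obtain n where n: "ennreal (r n) < q"
    proof (cases q)
      case (real t)
      then have "0 < t" using q(1) by simp
      then obtain n where "r n < t" using r(4) by blast
      then show ?thesis using that[of n] real r(3)[of n] by (simp add: ennreal_less_iff)
    next
      case top
      then show ?thesis using that by simp
    qed
    have "glued (f t) \<in> U" if t: "\<forall>i<n. t i = s i" for t
    proof -
      have "UD Y R (glued (f s)) (glued (f t)) \<le> ennreal (r n)"
        by (rule UD_glued_le[OF r(2) f_nonneg f_nonneg]) (rule f_close; use t in simp)+
      then show ?thesis using n F_UCPM[of t] q(2) by (auto dest: le_less_trans)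
    qed
    then show ?thesis by (intro exI[of _ n]) auto
  qed
  \<comment> \<open>Suslin sets are not closed under complements in general, so the induction over
    Borel sets carries both preimages along.\<close>
  have "suslin {s. glued (f s) \<in> B} \<and> suslin {s. glued (f s) \<notin> B}"
    if "B \<in> sigma_sets (UCPM Y R) {U. openin (UCPM_topology Y R) U}" for B
    using that
  proof (induction rule: sigma_sets.induct)
    case (Basic U)
    then have "\<exists>n. {t. \<forall>i<n. t i = s i} \<subseteq> {s. glued (f s) \<in> U}"
      if "s \<in> {s. glued (f s) \<in> U}" for s
      using open_pre[of U s] that by simp
    from suslin_open[of "{s. glued (f s) \<in> U}", OF this] show ?case
      by (simp add: Collect_neg_eq)
  next
    case Empty
    have "suslin ({} :: (nat \<Rightarrow> 'a) set)" "suslin (- {} :: (nat \<Rightarrow> 'a) set)"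
      by (rule suslin_open, simp)+
    then show ?case by simp
  next
    case (Compl B)
    then show ?case using F_UCPM by simp
  next
    case (Union B)
    have "suslin (\<Union>n. {s. glued (f s) \<in> B n})" "suslin (\<Inter>n. {s. glued (f s) \<notin> B n})"
      using Union.IH by (simp_all add: suslin_UN suslin_INT)
    moreover have "(\<Union>n. {s. glued (f s) \<in> B n}) = {s. glued (f s) \<in> (\<Union>n. B n)}"
      "(\<Inter>n. {s. glued (f s) \<notin> B n}) = {s. glued (f s) \<notin> (\<Union>n. B n)}" by auto
    ultimately show ?case by simp
  qed
  then have N: "suslin {s. glued (f s) \<notin> UMet Y R}"
    using assms(3) unfolding borel_in_def by simp
  \<comment> \<open>If \<open>s\<close> is none of the \<open>w x\<close>, every size is positive
    and \<open>glued_in_UMet\<close> applies.\<close>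
  have "{s. glued (f s) \<notin> UMet Y R} \<subseteq> w ` J"
  proof (rule ccontr)
    assume "\<not> ?thesis"
    then obtain s where s: "glued (f s) \<notin> UMet Y R" "s \<notin> w ` J" by blast
    then have "0 < f s i" for i using r(3) by (auto simp: f_def seq_gap_def)
    then show False using s(1) glued_in_UMet[of "f s"] f_in by blast
  qed
  then have thin: "sigma_thin w {x \<in> J. w x \<in> {s. glued (f s) \<notin> UMet Y R}}"
    by (rule suslin_sigma_thin[OF N _ J(2)])
  \<comment> \<open>The indices whose sequence is isolated by its prefix of length
    \<open>n\<close>.\<close>
  define S where "S n = {x \<in> J. \<forall>y\<in>J. (\<forall>i<n. w y i = w x i) \<longrightarrow> y = x}" for n :: nat
  have "sigma_thin w (S n)" for n
    by (rule sigma_thin_inj_on[of _ n]) (auto simp: S_def)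
  then have "sigma_thin w (\<Union>n. S n)" by (rule sigma_thin_UN)
  from sigma_thin_Un[OF thin this] have "sigma_thin w J"
  proof (rule sigma_thin_subset, intro subsetI)
    fix x assume x: "x \<in> J"
    show "x \<in> {x \<in> J. w x \<in> {s. glued (f s) \<notin> UMet Y R}} \<union> (\<Union>n. S n)"
    proof (cases "x \<in> (\<Union>n. S n)")
      case False
      \<comment> \<open>For non-isolated \<open>x\<close>, other sequences \<open>w y\<close> share
        arbitrarily long prefixes with \<open>w x\<close>. Classes of arbitrarily small size thus
        accumulate at the class of \<open>x\<close>, which has size 0.\<close>
      have "\<exists>y\<in>p ` topspace Y. y \<noteq> x \<and> 0 \<le> f (w x) y \<and> f (w x) y < e" if e: "0 < e" for e
      proof -
        obtain n where n: "r n < e" using r(4) e by blast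
        have "x \<notin> S n" using False by blast
        then obtain y where y: "y \<in> J" "y \<noteq> x" "\<forall>i<n. w y i = w x i"
          using x unfolding S_def by blast
        have "f (w x) y < e"
          using seq_gap_le[OF r(1,3), of n "w x" "w y"] y(1,3) n by (simp add: f_def)
        then show ?thesis using y(1,2) J(1) f_nonneg by blast
      qed
      moreover have "f (w x) x = 0" using x by (simp add: f_def seq_gap_def)
      ultimately have "glued (f (w x)) \<notin> UMet Y R"
        using J(1) x by (intro glued_not_in_UMet[of x]) auto
      then show ?thesis using x by simp
    qed simp
  qed
  then show False using J(3) by simp
qed

end
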